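(* Let $k=3$ and $\ell\ge3$. Then, over $\mathbb{F}_2$ in variables $x_1,x_2,x_3$, $$p_{\ell,0}=\sum_{\substack{a\ge b\ge c>0\\ a+b+c=2^\ell-1}}\binom{b+c}{c}\, m_{a,b,c},$$ $$p_{\ell,1}=\sum_{\substack{a\ge b>0\\ a+b=2^\ell-2}}(1+b)\,m_{a,b,0}+\sum_{\substack{a\ge b\ge c>0\\ a+b+c=2^\ell-2}}\left(1+\binom{b+c}{c-1}+\binom{b+c+1}{c+1}\right)m_{a,b,c},$$ $$p_{\ell,2}=\sum_{\substack{a\ge b\ge c\ge0\\ a+b+c=2^{\ell}-4}}\left(1+\binom{b+c+2}{c+1}\right)m_{a,b,c}.$$
   Context: $m_{a,b,c}$ denotes the monomial symmetric polynomial in $x_1,x_2,x_3$ over $\mathbb{F}_2$: the sum of all distinct monomials obtained from $x_1^{a}x_2^{b}x_3^{c}$ by permuting the variables (exponents may be $0$). For $k=3$, $\ell\ge3$ and $0\le j\le 2$, $p_{\ell,j}\in\mathbb{F}_2[x_1,x_2,x_3]$ is the polynomial $$p_{\ell,j}=\frac{m_{2^0,\ldots,\widehat{2^j},\ldots,2^{2},2^\ell}}{m_{2^0,2^1,2^{2}}},$$ where the hat denotes omission (so the numerators for $j=0,1,2$ are $m_{2,4,2^\ell}$, $m_{1,4,2^\ell}$, $m_{1,2,2^\ell}$); these ratios are known to be polynomials. Binomial coefficients are reduced mod $2$. *)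

theory Defs
  imports
    "HOL-Library.Poly_Mapping"
    "HOL-Library.Z2"
    "HOL-Library.Numeral_Type"
begin

text \<open>
  The ring of polynomials over the two-element field \<open>bit\<close> in exactly three variables, indexed by
  the three-element type \<open>3\<close>: a polynomial is a finitely supported map from exponent vectors to
  coefficients. Note that the literals \<open>1, 2, 3 :: 3\<close> are the three distinct elements of that
  type (with \<open>3 = 0\<close>), so the variables are \<open>X 1\<close>, \<open>X 2\<close>, \<open>X 3\<close>.
\<close>

type_synonym f2poly3 = "(3 \<Rightarrow>\<^sub>0 nat) \<Rightarrow>\<^sub>0 bit"

definition X :: "3 \<Rightarrow> f2poly3" where
  "X i = Poly_Mapping.single (Poly_Mapping.single i 1) 1"

text \<open>
  The sum ranges over a set of monomials, so a monomial produced by several permutations is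
  counted only once.
\<close>

definition msym :: "nat \<Rightarrow> nat \<Rightarrow> nat \<Rightarrow> f2poly3" where
  "msym a b c = (\<Sum>t \<in> {X (\<sigma> 1) ^ a * X (\<sigma> 2) ^ b * X (\<sigma> 3) ^ c | \<sigma> :: 3 \<Rightarrow> 3. bij \<sigma>}. t)"

text \<open>
  The two indices of \<open>{0, 1, 2}\<close> other than \<open>j\<close> are \<open>skip j 0 < skip j 1\<close>.
\<close>

definition skip :: "nat \<Rightarrow> nat \<Rightarrow> nat" where
  "skip j i = (if i < j then i else Suc i)"

definition p_numer :: "nat \<Rightarrow> nat \<Rightarrow> f2poly3" where
  "p_numer l j = msym (2 ^ skip j 0) (2 ^ skip j 1) (2 ^ l)"

text \<open>
  The quotient is the polynomial that multiplied by the denominator gives the numerator; it is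
  unique because the ring is a domain and the denominator is nonzero (\<open>p_eqI\<close> below).
\<close>

definition p :: "nat \<Rightarrow> nat \<Rightarrow> f2poly3" where
  "p l j = (THE q. q * msym (2 ^ 0) (2 ^ 1) (2 ^ 2) = p_numer l j)"

lemma p_numer_simps:
  "p_numer l 0 = msym 2 4 (2 ^ l)"
  "p_numer l 1 = msym 1 4 (2 ^ l)"
  "p_numer l 2 = msym 1 2 (2 ^ l)"
  by (simp_all add: p_numer_def skip_def)

lemma X_power: "X i ^ n = Poly_Mapping.single (Poly_Mapping.single i n) 1"
  by (induction n) (simp_all add: X_def mult_single flip: single_add)

lemma monomial_eq:
  "X i ^ a * X j ^ b * X k ^ c =
    Poly_Mapping.single
      (Poly_Mapping.single i a + Poly_Mapping.single j b + Poly_Mapping.single k c) 1"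
  by (simp add: X_power mult_single)

lemma denominator_nonzero: "msym (2 ^ 0) (2 ^ 1) (2 ^ 2) \<noteq> 0"
proof -
  define S :: "f2poly3 set" where
    "S = {X (\<sigma> 1) ^ 1 * X (\<sigma> 2) ^ 2 * X (\<sigma> 3) ^ 4 | \<sigma> :: 3 \<Rightarrow> 3. bij \<sigma>}"
  define e :: "3 \<Rightarrow>\<^sub>0 nat" where
    "e = Poly_Mapping.single 1 1 + Poly_Mapping.single 2 2 + Poly_Mapping.single 3 4"
  have fin: "finite S"
  proof -
    have "finite {\<sigma> :: 3 \<Rightarrow> 3. bij \<sigma>}" by simp
    then have "finite ((\<lambda>\<sigma>. X (\<sigma> 1) ^ 1 * X (\<sigma> 2) ^ 2 * X (\<sigma> 3) ^ 4) ` {\<sigma> :: 3 \<Rightarrow> 3. bij \<sigma>})"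
      by (rule finite_imageI)
    then show ?thesis
      unfolding S_def by (simp add: setcompr_eq_image)
  qed
  have mem: "Poly_Mapping.single e 1 \<in> S"
    unfolding S_def e_def monomial_eq by (intro CollectI exI[of _ id]) simp
  have val: "Poly_Mapping.lookup t e = (if t = Poly_Mapping.single e 1 then 1 else 0)"
    if "t \<in> S" for t
    using that unfolding S_def monomial_eq by (auto simp: lookup_single when_def)
  have "Poly_Mapping.lookup (\<Sum>t\<in>S. t) e = (\<Sum>t\<in>S. Poly_Mapping.lookup t e)"
    by (simp add: lookup_sum)
  also have "\<dots> = (\<Sum>t\<in>S. if t = Poly_Mapping.single e 1 then 1 else 0)"
    using val by (intro sum.cong) auto
  also have "\<dots> = 1"
    using fin mem by simp
  finally have "(\<Sum>t\<in>S. t) \<noteq> 0"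
    by auto
  then show ?thesis
    by (simp add: msym_def S_def)
qed

lemma p_eqI:
  assumes "q * msym (2 ^ 0) (2 ^ 1) (2 ^ 2) = p_numer l j"
  shows "p l j = q"
  unfolding p_def
proof (rule the_equality)
  show "q' = q" if "q' * msym (2 ^ 0) (2 ^ 1) (2 ^ 2) = p_numer l j" for q'
    using that assms denominator_nonzero by (metis mult_right_cancel)
qed (fact assms)

end

theory Submission
  imports Defs "HOL-Computational_Algebra.Primes" "HOL-Analysis.Cartesian_Space"
begin

text \<open>
  Write \<open>x, y, z\<close> for the variables, \<open>L = 2 ^ l\<close>, and let \<open>M\<close> be the denominator. Over the field with
  two elements \<open>M\<close> is a Moore determinant: it is the product of the seven nonzero linear forms in
  \<open>x, y, z\<close>. Three observations turn the theorem into polynomial identities.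

  \<^bold>\<open>The sorted sums are unsorted sums.\<close> On \<open>a + b + c = L - 1\<close> the residue of \<open>(b + c) choose c\<close>
  mod \<open>2\<close> is symmetric in \<open>a, b, c\<close> (\<open>odd_choose_exchange\<close>). Let \<open>g a b c\<close> be this residue when all
  three exponents are positive, and \<open>0\<close> otherwise; this is \<open>interior_choose\<close>. A short
  calculation with Pascal's rule writes all coefficients of the theorem through \<open>g\<close>: they are
  \<open>g a b c\<close> for \<open>j = 0\<close>, \<open>[a, b, c > 0] + g (a+1) b c + g a (b+1) c + g a b (c+1)\<close> for \<open>j = 1\<close>
  (which covers the terms with \<open>c = 0\<close> as well), and \<open>1 + g (a+1) (b+1) (c+1)\<close> for \<open>j = 2\<close>. They are
  symmetric, so that a sum over \<open>a \<ge> b \<ge> c\<close> of multiples of monomial symmetric polynomials equals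
  the sum over all \<open>(a, b, c)\<close> of the same multiples of monomials (\<open>sum_msym_eq_ternary_form\<close>).

  \<^bold>\<open>The first quotient is a sum of powers of linear forms.\<close> Let \<open>r\<close> be the form of degree \<open>L - 1\<close> with
  coefficients \<open>g\<close>. By the binomial theorem \<open>r\<close> is the sum of \<open>S (y + z)\<close>, \<open>S y\<close>, \<open>S z\<close>, \<open>x ^ (L-1)\<close>,
  \<open>(y + z) ^ (L-1)\<close>, \<open>y ^ (L-1)\<close> and \<open>z ^ (L-1)\<close>, where \<open>(x + w) * S w = x ^ L + w ^ L\<close>. As \<open>L\<close>-th
  powers are additive, each summand times the corresponding linear form is a sum of \<open>L\<close>-th powers of
  variables. Each linear form divides \<open>M\<close>, so \<open>M * r\<close> is a combination of
  \<open>x ^ L, y ^ L, z ^ L\<close> with polynomial coefficients, which expand to the numerator for \<open>j = 0\<close>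
  (\<open>interior_form_times_moore\<close>).

  \<^bold>\<open>The other two quotients reduce to the first.\<close> Let \<open>h N\<close> be the complete homogeneous symmetric
  polynomial of degree \<open>N\<close>. Shifting exponents in the coefficient formulas shows that the right-hand
  sides \<open>q1, q2\<close> for \<open>j = 1, 2\<close> satisfy
  \<open>x*y*z * q1 = (x*y*z)^2 * h (L-5) + (x*y + x*z + y*z) * r\<close> and \<open>x*y*z * q2 = x*y*z * h (L-4) + r\<close>.
  The product of \<open>h N\<close> with the Vandermonde factor \<open>(x + y) * (x + z) * (y + z)\<close> of \<open>M\<close> is the
  alternant \<open>x ^ (N+2) * (y + z) + y ^ (N+2) * (x + z) + z ^ (N+2) * (x + y)\<close>, so \<open>M * q1\<close> and
  \<open>M * q2\<close> can be computed after multiplication by \<open>x*y*z\<close>, which is then cancelled.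
\<close>

section \<open>Ternary forms with prescribed coefficients\<close>

definition simplex :: "nat \<Rightarrow> (nat \<times> nat \<times> nat) set" where
  "simplex N = {(a, b, c). a + b + c = N}"

definition ternary_form ::
    "nat \<Rightarrow> (nat \<Rightarrow> nat \<Rightarrow> nat \<Rightarrow> 'a) \<Rightarrow> 'a \<Rightarrow> 'a \<Rightarrow> 'a \<Rightarrow> 'a::comm_ring_1" where
  "ternary_form N f x y z = (\<Sum>(a, b, c) \<in> simplex N. f a b c * x ^ a * y ^ b * z ^ c)"

lemma finite_simplex [simp]: "finite (simplex N)"
  by (rule finite_subset[of _ "{..N} \<times> {..N} \<times> {..N}"]) (auto simp: simplex_def)

lemma ternary_form_add:
  "ternary_form N (\<lambda>a b c. f a b c + g a b c) x y z =
     ternary_form N f x y z + ternary_form N g x y z"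
  by (simp add: ternary_form_def sum.distrib[symmetric] distrib_right case_prod_unfold)

text \<open>
  Division of a form by a variable is a shift of its coefficient function. This and the next lemmas
  compare the three coefficient patterns of the theorem, whose degrees \<open>2 ^ l - 1\<close>, \<open>2 ^ l - 2\<close> and
  \<open>2 ^ l - 4\<close> differ.
\<close>

lemma ternary_form_shift1:
  assumes "\<And>b c. f 0 b c = 0"
  shows "ternary_form (Suc N) f x y z = x * ternary_form N (\<lambda>a b c. f (Suc a) b c) x y z"
proof -
  have "ternary_form (Suc N) f x y z =
      (\<Sum>(a, b, c) \<in> (\<lambda>(a, b, c). (Suc a, b, c)) ` simplex N. f a b c * x ^ a * y ^ b * z ^ c)"
    unfolding ternary_form_def
  proof (rule sum.mono_neutral_right)
    show "\<forall>t \<in> simplex (Suc N) - (\<lambda>(a, b, c). (Suc a, b, c)) ` simplex N.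
        (case t of (a, b, c) \<Rightarrow> f a b c * x ^ a * y ^ b * z ^ c) = 0"
    proof (clarify)
      fix a b c
      assume "(a, b, c) \<in> simplex (Suc N)"
        and "(a, b, c) \<notin> (\<lambda>(a, b, c). (Suc a, b, c)) ` simplex N"
      then have "a = 0"
        by (cases a) (force simp: simplex_def)+
      then show "f a b c * x ^ a * y ^ b * z ^ c = 0"
        using assms by simp
    qed
  qed (simp, auto simp: simplex_def)
  also have "\<dots> = x * ternary_form N (\<lambda>a b c. f (Suc a) b c) x y z"
    unfolding ternary_form_def sum_distrib_left
    by (subst sum.reindex) (auto simp: inj_on_def intro!: sum.cong)
  finally show ?thesis .
qed

lemma ternary_form_rotate:
  "ternary_form N f x y z = ternary_form N (\<lambda>b c a. f a b c) y z x"
  unfolding ternary_form_def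
  by (rule sum.reindex_bij_witness[of _ "\<lambda>(b, c, a). (a, b, c)" "\<lambda>(a, b, c). (b, c, a)"])
     (auto simp: simplex_def mult_ac)

lemma ternary_form_shift2:
  assumes "\<And>a c. f a 0 c = 0"
  shows "ternary_form (Suc N) f x y z = y * ternary_form N (\<lambda>a b c. f a (Suc b) c) x y z"
proof -
  have "ternary_form (Suc N) f x y z = ternary_form (Suc N) (\<lambda>b c a. f a b c) y z x"
    by (rule ternary_form_rotate)
  also have "\<dots> = y * ternary_form N (\<lambda>b c a. f a (Suc b) c) y z x"
    by (rule ternary_form_shift1) (rule assms)
  also have "\<dots> = y * ternary_form N (\<lambda>a b c. f a (Suc b) c) x y z"
    by (subst (2) ternary_form_rotate) (rule refl)
  finally show ?thesis .
qed

lemma ternary_form_shift3: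
  assumes "\<And>a b. f a b 0 = 0"
  shows "ternary_form (Suc N) f x y z = z * ternary_form N (\<lambda>a b c. f a b (Suc c)) x y z"
proof -
  have "ternary_form (Suc N) f x y z = ternary_form (Suc N) (\<lambda>b c a. f a b c) y z x"
    by (rule ternary_form_rotate)
  also have "\<dots> = z * ternary_form N (\<lambda>b c a. f a b (Suc c)) y z x"
    by (rule ternary_form_shift2) (rule assms)
  also have "\<dots> = z * ternary_form N (\<lambda>a b c. f a b (Suc c)) x y z"
    by (subst (2) ternary_form_rotate) (rule refl)
  finally show ?thesis .
qed

lemma ternary_form_shift_all:
  assumes "\<And>a b c. a = 0 \<or> b = 0 \<or> c = 0 \<Longrightarrow> f a b c = 0"
  shows "ternary_form (N + 3) f x y z =
    x * y * z * ternary_form N (\<lambda>a b c. f (Suc a) (Suc b) (Suc c)) x y z"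
proof -
  have "ternary_form (Suc (Suc (Suc N))) f x y z =
      x * ternary_form (Suc (Suc N)) (\<lambda>a b c. f (Suc a) b c) x y z"
    by (rule ternary_form_shift1) (simp add: assms)
  also have "ternary_form (Suc (Suc N)) (\<lambda>a b c. f (Suc a) b c) x y z =
      y * ternary_form (Suc N) (\<lambda>a b c. f (Suc a) (Suc b) c) x y z"
    by (rule ternary_form_shift2) (simp add: assms)
  also have "ternary_form (Suc N) (\<lambda>a b c. f (Suc a) (Suc b) c) x y z =
      z * ternary_form N (\<lambda>a b c. f (Suc a) (Suc b) (Suc c)) x y z"
    by (rule ternary_form_shift3) (simp add: assms)
  finally show ?thesis
    by (simp add: mult.assoc numeral_3_eq_3)
qed

text \<open>
  Sorting the monomials by the power of \<open>x\<close> makes the inner sum a binary form of degree \<open>n\<close> in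
  \<open>y\<close> and \<open>z\<close>, to which the binomial theorem or the geometric sum applies.
\<close>

lemma ternary_form_slices:
  "ternary_form N f x y z =
     (\<Sum>n\<le>N. x ^ (N - n) * (\<Sum>c\<le>n. f (N - n) (n - c) c * y ^ (n - c) * z ^ c))"
proof -
  have "ternary_form N f x y z =
      (\<Sum>(n, c) \<in> Sigma {..N} (\<lambda>n. {..n}). x ^ (N - n) * (f (N - n) (n - c) c * y ^ (n - c) * z ^ c))"
    unfolding ternary_form_def
    by (rule sum.reindex_bij_witness[of _ "\<lambda>(n, c). (N - n, n - c, c)" "\<lambda>(a, b, c). (b + c, c)"])
       (auto simp: simplex_def mult_ac)
  then show ?thesis
    by (simp add: sum.Sigma[symmetric] sum_distrib_left)
qed

lemma power_sum_mult_diff: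
  fixes x y :: "'a::comm_ring_1"
  shows "(x - y) * (\<Sum>n\<le>N. x ^ (N - n) * y ^ n) = x ^ Suc N - y ^ Suc N"
  by (subst power_diff_sumr2, rule arg_cong[where f = "(*) (x - y)"],
      rule sum.reindex_bij_witness[of _ "\<lambda>i. N - i" "\<lambda>i. N - i"]) (auto simp: mult.commute)

text \<open>
  The bialternant formula for complete homogeneous polynomials in three variables: two
  geometric sums, the inner one against \<open>y - z\<close> and the outer one against \<open>x - y\<close> and \<open>x - z\<close>.
\<close>

lemma vandermonde_times_complete:
  fixes x y z :: "'a::comm_ring_1"
  shows "(x - y) * (x - z) * (y - z) * ternary_form N (\<lambda>_ _ _. 1) x y z =
    x ^ (N + 2) * (y - z) - y ^ (N + 2) * (x - z) + z ^ (N + 2) * (x - y)"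
proof -
  define h where "h w = (\<Sum>n\<le>N. x ^ (N - n) * w ^ n)" for w
  have h: "(x - w) * h w = x ^ Suc N - w ^ Suc N" for w
    unfolding h_def by (rule power_sum_mult_diff)
  have "(y - z) * ternary_form N (\<lambda>_ _ _. 1) x y z
      = (\<Sum>n\<le>N. x ^ (N - n) * ((y - z) * (\<Sum>c\<le>n. y ^ (n - c) * z ^ c)))"
    by (simp add: ternary_form_slices sum_distrib_left mult_ac)
  also have "\<dots> = (\<Sum>n\<le>N. x ^ (N - n) * (y ^ Suc n - z ^ Suc n))"
    by (simp only: power_sum_mult_diff)
  also have "\<dots> = y * h y - z * h z"
    by (simp add: h_def sum_distrib_left sum_subtractf algebra_simps)
  finally have "(x - y) * (x - z) * (y - z) * ternary_form N (\<lambda>_ _ _. 1) x y z =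
      (x - y) * (x - z) * (y * h y - z * h z)"
    by (simp only: mult.assoc)
  also have "\<dots> = (x - z) * y * ((x - y) * h y) - (x - y) * z * ((x - z) * h z)"
    by (simp add: algebra_simps)
  finally show ?thesis
    unfolding h by (simp add: algebra_simps)
qed

section \<open>Parity of binomial coefficients\<close>

text \<open>
  Consecutive entries of row \<open>2 ^ l - 1\<close> of Pascal's triangle add up to an inner entry of row
  \<open>2 ^ l\<close>, and this is even: by absorption \<open>2 ^ l\<close> divides \<open>k * (2 ^ l choose k)\<close>, but not \<open>k\<close>.
\<close>

lemma odd_choose_pred_two_power:
  assumes "k < 2 ^ l"
  shows "odd ((2 ^ l - 1) choose k)"
  using assms
proof (induction k)
  case (Suc k)
  have eq: "Suc (2 ^ l - 1) = (2::nat) ^ l" by simp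
  have "Suc k * (2 ^ l choose Suc k) = 2 ^ l * ((2 ^ l - 1) choose k)"
    using Suc_times_binomial[of k "2 ^ l - 1"] by simp
  then have dvd: "2 ^ l dvd Suc k * (2 ^ l choose Suc k)"
    by simp
  have "even (2 ^ l choose Suc k)"
  proof (rule ccontr)
    assume "odd (2 ^ l choose Suc k)"
    then have "coprime (2 ^ l) (2 ^ l choose Suc k)"
      by simp
    with dvd have "2 ^ l dvd Suc k"
      using coprime_dvd_mult_left_iff by blast
    with Suc.prems show False
      using nat_dvd_not_less by blast
  qed
  moreover have "2 ^ l choose Suc k = ((2 ^ l - 1) choose k) + ((2 ^ l - 1) choose Suc k)"
    by (subst eq[symmetric], subst binomial_Suc_Suc) (rule refl)
  ultimately show ?case
    using Suc by simp
qed simp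

text \<open>
  As functions of \<open>b\<close>, with \<open>a\<close> tied to \<open>b\<close> by the sum, both sides satisfy the same Pascal recurrence
  modulo \<open>2\<close>: the differences of neighbouring values agree by induction on \<open>c\<close>, and the
  initial values at \<open>b = 0\<close> are \<open>1\<close> and an entry of row \<open>2 ^ l - 1\<close>, which is odd. Behind this is
  \<open>(x + y + z) ^ (2 ^ l - 1)\<close>, whose coefficients are these residues and which is symmetric.
\<close>

lemma odd_choose_exchange:
  assumes "a + b + c = 2 ^ l - 1"
  shows "odd ((b + c) choose c) \<longleftrightarrow> odd ((a + c) choose c)"
  using assms
proof (induction c arbitrary: a b)
  case (Suc c)
  note IH = Suc.IH
  from Suc.prems show ?case
  proof (induction b arbitrary: a)
    case 0
    have "a + Suc c = 2 ^ l - 1" using 0 by simp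
    moreover have "Suc c < 2 ^ l" using 0 by (simp add: less_diff_conv)
    ultimately show ?case
      using odd_choose_pred_two_power[of "Suc c" l] by simp
  next
    case (Suc b)
    have "odd ((b + Suc c) choose Suc c) \<longleftrightarrow> odd ((Suc a + Suc c) choose Suc c)"
      by (rule Suc.IH) (use Suc.prems in simp)
    moreover have "odd ((Suc b + c) choose c) \<longleftrightarrow> odd ((Suc a + c) choose c)"
      by (rule IH) (use Suc.prems in simp)
    ultimately show ?case by auto
  qed
qed simp

lemma of_nat_cong_parity:
  assumes "CHAR('a::comm_ring_1) = 2" "odd m \<longleftrightarrow> odd n"
  shows "of_nat m = (of_nat n :: 'a)"
proof -
  have two: "(2 :: 'a) = 0"
    using of_nat_CHAR[where 'a = 'a] assms(1) by simp
  have "of_nat k = (of_bool (odd k) :: 'a)" for k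
    using two by (cases "even k") (auto elim!: evenE oddE)
  then show ?thesis
    using assms(2) by simp
qed

text \<open>
  For \<open>a + b + c = 2 ^ l - 1\<close> and in characteristic two, these are the coefficients of
  \<open>(x + y + z) ^ (2 ^ l - 1)\<close> at the monomials divisible by \<open>x * y * z\<close>.
  Setting the others to \<open>0\<close> makes the form divisible by each variable.
\<close>

definition interior_choose :: "nat \<Rightarrow> nat \<Rightarrow> nat \<Rightarrow> 'a::comm_ring_1" where
  "interior_choose a b c = (if 0 < a \<and> 0 < b \<and> 0 < c then of_nat ((b + c) choose c) else 0)"

lemma interior_choose_swap23:
  "interior_choose a b c = interior_choose a c b"
  unfolding interior_choose_def
  using binomial_symmetric[of c "b + c"] by (simp add: add.commute)

lemma interior_choose_swap12:
  assumes "CHAR('a::comm_ring_1) = 2" "a + b + c = 2 ^ l - 1"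
  shows "interior_choose a b c = (interior_choose b a c :: 'a)"
  using of_nat_cong_parity[OF assms(1) odd_choose_exchange[OF assms(2)]]
  unfolding interior_choose_def by simp

section \<open>The quotient with index 0\<close>

text \<open>
  As rewrite rules together with \<open>algebra_simps\<close>, these decide polynomial identities in
  characteristic two: sorting the summands brings equal monomials side by side, where they cancel.
\<close>

lemma cancel_CHAR_2:
  fixes x y :: "'a::comm_ring_1"
  assumes "CHAR('a) = 2"
  shows "x + x = 0" "x + (x + y) = y" "(2::'a) = 0"
proof -
  show *: "(2::'a) = 0" using of_nat_CHAR[where 'a = 'a] assms by simp
  show "x + x = 0" using * by (simp flip: mult_2)
  then show "x + (x + y) = y" by (simp flip: add.assoc)
qed

text \<open>
  The slice of degree \<open>n\<close> in \<open>y, z\<close> is \<open>(y + z) ^ n\<close> without its two end terms. The slices \<open>n = 0\<close> and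
  \<open>n = N\<close> lie on the boundary and vanish.
\<close>

lemma interior_slice:
  fixes y z :: "'a::comm_ring_1"
  assumes "CHAR('a) = 2" "n \<le> N"
  shows "(\<Sum>c\<le>n. interior_choose (N - n) (n - c) c * y ^ (n - c) * z ^ c) =
    (if n = 0 \<or> n = N then 0 else (y + z) ^ n + y ^ n + z ^ n)"
proof (cases "n = 0 \<or> n = N")
  case True
  then show ?thesis by (auto simp: interior_choose_def)
next
  case False
  have mid: "(\<Sum>c\<le>n. g c) = g 0 + (\<Sum>c\<in>{0<..<n}. g c) + g n" for g :: "nat \<Rightarrow> 'a"
  proof -
    have "{..n} = insert 0 (insert n {0<..<n})" using False by auto
    then show ?thesis using False by (simp add: ac_simps)
  qed
  have "(z + y) ^ n = (\<Sum>c\<le>n. of_nat (n choose c) * z ^ c * y ^ (n - c))"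
    by (rule binomial_ring)
  also have "\<dots> = y ^ n + (\<Sum>c\<in>{0<..<n}. of_nat (n choose c) * z ^ c * y ^ (n - c)) + z ^ n"
    by (subst mid) simp
  also have "(\<Sum>c\<in>{0<..<n}. of_nat (n choose c) * z ^ c * y ^ (n - c)) =
      (\<Sum>c\<le>n. interior_choose (N - n) (n - c) c * y ^ (n - c) * z ^ c)"
    using False assms(2)
    by (subst mid) (auto simp: interior_choose_def mult_ac intro!: sum.cong)
  finally show ?thesis
    using False by (simp add: cancel_CHAR_2[OF assms(1)] ac_simps)
qed

text \<open>
  Extending the sum over the slices \<open>0 < n < N\<close> to all \<open>n \<le> N\<close> creates \<open>3 * x ^ N\<close>, which is \<open>x ^ N\<close>,
  at \<open>n = 0\<close>, and the last three powers at \<open>n = N\<close>; they are added once more to compensate.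
\<close>

lemma interior_form_eq_power_sums:
  fixes x y z :: "'a::comm_ring_1"
  assumes "CHAR('a) = 2" "0 < N"
  defines "S \<equiv> \<lambda>w. (\<Sum>n\<le>N. x ^ (N - n) * w ^ n)"
  shows "ternary_form N interior_choose x y z =
    S (y + z) + S y + S z + x ^ N + (y + z) ^ N + y ^ N + z ^ N"
proof -
  have "ternary_form N interior_choose x y z =
      (\<Sum>n\<le>N. x ^ (N - n) * (if n = 0 \<or> n = N then 0 else (y + z) ^ n + y ^ n + z ^ n))"
    unfolding ternary_form_slices by (intro sum.cong) (simp_all add: interior_slice assms(1))
  also have "\<dots> = (\<Sum>n\<in>{0<..<N}. x ^ (N - n) * ((y + z) ^ n + y ^ n + z ^ n))"
    by (rule sum.mono_neutral_cong_right) auto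
  finally have T: "ternary_form N interior_choose x y z =
      (\<Sum>n\<in>{0<..<N}. x ^ (N - n) * (y + z) ^ n) + (\<Sum>n\<in>{0<..<N}. x ^ (N - n) * y ^ n)
      + (\<Sum>n\<in>{0<..<N}. x ^ (N - n) * z ^ n)"
    by (simp add: distrib_left sum.distrib)
  have "{..N} = insert 0 (insert N {0<..<N})" using assms(2) by auto
  then have S: "S w = x ^ N + w ^ N + (\<Sum>n\<in>{0<..<N}. x ^ (N - n) * w ^ n)" for w
    unfolding S_def using assms(2) by (simp add: ac_simps)
  show ?thesis
    unfolding T S by (simp add: cancel_CHAR_2[OF assms(1)] ac_simps)
qed

text \<open>
  The product of the nonzero linear forms over the two-element field, which is the Moore determinant
  of \<open>x, y, z\<close> in characteristic two.
\<close>

definition moore :: "'a \<Rightarrow> 'a \<Rightarrow> 'a \<Rightarrow> 'a::comm_ring_1" where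
  "moore x y z = x * y * z * (x + y) * (x + z) * (y + z) * (x + y + z)"

text \<open>
  Each of the seven summands of the interior form is matched with the linear factor of the Moore
  determinant by which its product is a sum of \<open>2 ^ l\<close>-th powers of variables.
\<close>

lemma interior_form_times_moore:
  fixes x y z :: "'a::comm_ring_1"
  assumes char2: "CHAR('a) = 2" and l: "0 < l"
  defines "L \<equiv> 2 ^ l"
  shows "moore x y z * ternary_form (L - 1) interior_choose x y z =
    x ^ L * (y * z * (y + z))\<^sup>2 + y ^ L * (x * z * (x + z))\<^sup>2 + z ^ L * (x * y * (x + y))\<^sup>2"
proof -
  define S where "S w = (\<Sum>n\<le>L - 1. x ^ (L - 1 - n) * w ^ n)" for w
  have L: "Suc (L - 1) = L" "0 < L - 1"
    unfolding L_def using one_less_power[of "2::nat" l] l by auto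
  have frob: "(u + v) ^ L = u ^ L + v ^ L" for u v :: 'a
    unfolding L_def by (rule freshmans_dream') (simp_all add: char2)
  have S: "(x + w) * S w = x ^ L + w ^ L" for w
    using power_sum_mult_diff[of x w "L - 1"] unfolding S_def L
    by (simp add: minus_CHAR_2 char2)
  have pow: "w * w ^ (L - 1) = w ^ L" for w :: 'a
    using L(1) by (metis power_Suc)
  have S': "(x + y + z) * S (y + z) = x ^ L + y ^ L + z ^ L"
    using S[of "y + z"] by (simp add: frob add.assoc)
  have "moore x y z * ternary_form (L - 1) interior_choose x y z =
      moore x y z * S (y + z) + moore x y z * S y + moore x y z * S z +
      moore x y z * x ^ (L - 1) + moore x y z * (y + z) ^ (L - 1) +
      moore x y z * y ^ (L - 1) + moore x y z * z ^ (L - 1)"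
    unfolding interior_form_eq_power_sums[OF char2 L(2)] S_def[symmetric] by (simp only: distrib_left)
  also have "\<dots> =
      x * y * z * (x + y) * (x + z) * (y + z) * ((x + y + z) * S (y + z)) +
      x * y * z * (x + z) * (y + z) * (x + y + z) * ((x + y) * S y) +
      x * y * z * (x + y) * (y + z) * (x + y + z) * ((x + z) * S z) +
      y * z * (x + y) * (x + z) * (y + z) * (x + y + z) * (x * x ^ (L - 1)) +
      x * y * z * (x + y) * (x + z) * (x + y + z) * ((y + z) * (y + z) ^ (L - 1)) +
      x * z * (x + y) * (x + z) * (y + z) * (x + y + z) * (y * y ^ (L - 1)) +
      x * y * (x + y) * (x + z) * (y + z) * (x + y + z) * (z * z ^ (L - 1))"
    unfolding moore_def by (simp only: mult_ac)
  also have "\<dots> = x ^ L * (y * z * (y + z))\<^sup>2 + y ^ L * (x * z * (x + z))\<^sup>2 +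
      z ^ L * (x * y * (x + y))\<^sup>2"
    unfolding S' S pow frob unfolding power2_eq_square
    by (simp add: algebra_simps cancel_CHAR_2[OF char2])
  finally show ?thesis .
qed

section \<open>The quotients with index 1 and 2\<close>

lemma moore_times_complete:
  fixes x y z :: "'a::comm_ring_1"
  assumes "CHAR('a) = 2"
  shows "moore x y z * ternary_form N (\<lambda>_ _ _. 1) x y z =
    x * y * z * (x + y + z) *
      (x ^ (N + 2) * (y + z) + y ^ (N + 2) * (x + z) + z ^ (N + 2) * (x + y))"
proof -
  have "moore x y z * ternary_form N (\<lambda>_ _ _. 1) x y z = x * y * z * (x + y + z) *
      ((x + y) * (x + z) * (y + z) * ternary_form N (\<lambda>_ _ _. 1) x y z)"
    unfolding moore_def by (simp only: mult_ac)
  then show ?thesis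
    using vandermonde_times_complete[of x y z N]
    by (simp only: minus_CHAR_2[OF assms])
qed

text \<open>
  Multiplied by \<open>x * y * z\<close>, the form on the left becomes \<open>x * y * z\<close> times a complete homogeneous
  polynomial, plus the interior form of degree \<open>2 ^ l - 1\<close>; both have known products with the
  Moore determinant.
\<close>

lemma shifted_form_times_moore:
  fixes x y z :: "'a::idom"
  assumes char2: "CHAR('a) = 2" and l: "2 \<le> l" and nz: "x \<noteq> 0" "y \<noteq> 0" "z \<noteq> 0"
  defines "L \<equiv> 2 ^ l"
  shows "moore x y z *
      ternary_form (L - 4) (\<lambda>a b c. 1 + interior_choose (Suc a) (Suc b) (Suc c)) x y z =
    x ^ L * (y * z * (y + z)) + y ^ L * (x * z * (x + z)) + z ^ L * (x * y * (x + y))"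
    (is "?M * ?T = ?R")
proof -
  define h where "h = ternary_form (L - 4) (\<lambda>_ _ _. 1) x y z"
  define r where "r = ternary_form (L - 1) interior_choose x y z"
  have "2 ^ 2 \<le> L"
    unfolding L_def using l by (intro power_increasing) auto
  then have L: "L - 4 + 3 = L - 1" "L - 4 + 2 + 2 = L"
    by auto
  have r: "r = x * y * z *
      ternary_form (L - 4) (\<lambda>a b c. interior_choose (Suc a) (Suc b) (Suc c)) x y z"
    unfolding r_def L(1)[symmetric]
    by (rule ternary_form_shift_all) (auto simp: interior_choose_def)
  have Mh: "?M * h = x * y * z * (x + y + z) * (x ^ (L - 4 + 2) * (y + z) +
      y ^ (L - 4 + 2) * (x + z) + z ^ (L - 4 + 2) * (x + y))"
    unfolding h_def by (rule moore_times_complete[OF char2])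
  have Mr: "?M * r = x ^ L * (y * z * (y + z))\<^sup>2 + y ^ L * (x * z * (x + z))\<^sup>2 +
      z ^ L * (x * y * (x + y))\<^sup>2"
    unfolding r_def L_def by (rule interior_form_times_moore) (use char2 l in auto)
  \<comment> \<open>All powers get the exponent of \<open>Mh\<close>, so that expansion can match them.\<close>
  have pow: "w ^ L = w ^ (L - 4 + 2) * w\<^sup>2" for w :: 'a
    by (metis L(2) power_add)
  have "x * y * z * (?M * ?T) = x * y * z * (?M * h) + ?M * r"
    unfolding ternary_form_add r h_def by (simp add: distrib_left mult_ac)
  also have "\<dots> = x * y * z * ?R"
    unfolding Mh Mr pow unfolding power2_eq_square
    by (simp add: algebra_simps cancel_CHAR_2[OF char2])
  finally show ?thesis
    using nz by simp
qed

text \<open>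
  The coefficients for index \<open>1\<close>, written so that their symmetry follows from that of
  \<open>interior_choose\<close>: the three shifts are the coefficients of the interior form multiplied by
  \<open>1 / x + 1 / y + 1 / z\<close>.
\<close>

definition middle_coeff :: "nat \<Rightarrow> nat \<Rightarrow> nat \<Rightarrow> 'a::comm_ring_1" where
  "middle_coeff a b c = of_bool (0 < a \<and> 0 < b \<and> 0 < c) +
     (interior_choose (Suc a) b c + (interior_choose a (Suc b) c + interior_choose a b (Suc c)))"

text \<open>
  Multiplication by \<open>x * y * z\<close> turns the three shifts into \<open>y * z + x * z + x * y\<close> times the
  interior form, and the indicator of the interior into \<open>(x * y * z)\<^sup>2\<close> times a complete
  homogeneous polynomial, of degree \<open>2 ^ l - 5\<close>.
\<close>

lemma middle_form_times_moore:
  fixes x y z :: "'a::idom"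
  assumes char2: "CHAR('a) = 2" and l: "3 \<le> l" and nz: "x \<noteq> 0" "y \<noteq> 0" "z \<noteq> 0"
  defines "L \<equiv> 2 ^ l"
  shows "moore x y z * ternary_form (L - 2) middle_coeff x y z =
    x ^ L * (y * z * (y ^ 3 + z ^ 3)) + y ^ L * (x * z * (x ^ 3 + z ^ 3)) +
    z ^ L * (x * y * (x ^ 3 + y ^ 3))"
    (is "?M * ?T = ?R")
proof -
  define h where "h = ternary_form (L - 5) (\<lambda>_ _ _. 1) x y z"
  define r where "r = ternary_form (L - 1) interior_choose x y z"
  have "2 ^ 3 \<le> L"
    unfolding L_def using l by (intro power_increasing) auto
  then have L: "Suc (L - 2) = L - 1" "L - 5 + 3 = L - 2" "L - 5 + 2 + 3 = L"
    by auto
  have h: "ternary_form (L - 2) (\<lambda>a b c. of_bool (0 < a \<and> 0 < b \<and> 0 < c)) x y z = x * y * z * h"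
    unfolding h_def L(2)[symmetric] by (subst ternary_form_shift_all) auto
  have r: "r = x * ternary_form (L - 2) (\<lambda>a b c. interior_choose (Suc a) b c) x y z"
    "r = y * ternary_form (L - 2) (\<lambda>a b c. interior_choose a (Suc b) c) x y z"
    "r = z * ternary_form (L - 2) (\<lambda>a b c. interior_choose a b (Suc c)) x y z"
    unfolding r_def L(1)[symmetric]
    by (rule ternary_form_shift1 ternary_form_shift2 ternary_form_shift3,
        simp add: interior_choose_def)+
  have Mh: "?M * h = x * y * z * (x + y + z) * (x ^ (L - 5 + 2) * (y + z) +
      y ^ (L - 5 + 2) * (x + z) + z ^ (L - 5 + 2) * (x + y))"
    unfolding h_def by (rule moore_times_complete[OF char2])
  have Mr: "?M * r = x ^ L * (y * z * (y + z))\<^sup>2 + y ^ L * (x * z * (x + z))\<^sup>2 +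
      z ^ L * (x * y * (x + y))\<^sup>2"
    unfolding r_def L_def by (rule interior_form_times_moore) (use char2 l in auto)
  \<comment> \<open>All powers get the exponent of \<open>Mh\<close>, so that expansion can match them.\<close>
  have pow: "w ^ L = w ^ (L - 5 + 2) * w ^ 3" for w :: 'a
    by (metis L(3) power_add)
  have "x * y * z * ?T = (x * y * z)\<^sup>2 * h + (y * z + x * z + x * y) * r"
    unfolding middle_coeff_def ternary_form_add h distrib_right
    by (subst r(1), subst r(2), subst r(3)) (simp add: algebra_simps power2_eq_square)
  then have "x * y * z * (?M * ?T) = (x * y * z)\<^sup>2 * (?M * h) + (y * z + x * z + x * y) * (?M * r)"
    by (simp add: algebra_simps)
  also have "\<dots> = x * y * z * ?R"
    unfolding Mh Mr pow unfolding power2_eq_square power3_eq_cube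
    by (simp add: algebra_simps cancel_CHAR_2[OF char2])
  finally show ?thesis
    using nz by simp
qed

section \<open>Monomial symmetric polynomials\<close>

text \<open>
  Coinciding arrangements are identified because this is a set, which matches the convention that
  a monomial symmetric polynomial has each of its monomials once.
\<close>

definition arrangements :: "nat \<Rightarrow> nat \<Rightarrow> nat \<Rightarrow> (nat \<times> nat \<times> nat) set" where
  "arrangements a b c = {(a, b, c), (a, c, b), (b, a, c), (b, c, a), (c, a, b), (c, b, a)}"

lemma inj_monomial: "inj (\<lambda>(a, b, c). X 1 ^ a * X 2 ^ b * X 3 ^ c)"
proof (rule injI, unfold split_paired_all prod.case)
  fix a b c a' b' c' :: nat
  define e where "e a b c = Poly_Mapping.single (1::3) a + Poly_Mapping.single 2 b +
    Poly_Mapping.single 3 c" for a b c :: nat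
  assume "X 1 ^ a * X 2 ^ b * X 3 ^ c = X 1 ^ a' * X 2 ^ b' * X 3 ^ c'"
  then have "Poly_Mapping.single (e a b c) (1::bit) = Poly_Mapping.single (e a' b' c') 1"
    by (simp only: monomial_eq e_def)
  then have "e a b c = e a' b' c'"
    by (metis lookup_single_eq lookup_single_not_eq zero_neq_one)
  then have "Poly_Mapping.lookup (e a b c) i = Poly_Mapping.lookup (e a' b' c') i" for i
    by simp
  from this[of 1] this[of 2] this[of 3] show "(a, b, c) = (a', b', c')"
    by (simp_all add: e_def lookup_add lookup_single)
qed

lemma permuted_monomials:
  "{X (\<sigma> 1) ^ a * X (\<sigma> 2) ^ b * X (\<sigma> 3) ^ c | \<sigma> :: 3 \<Rightarrow> 3. bij \<sigma>} =
     (\<lambda>(a, b, c). X 1 ^ a * X 2 ^ b * X 3 ^ c) ` arrangements a b c"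
    (is "?A = ?B")
proof
  show "?A \<subseteq> ?B"
  proof clarify
    fix \<sigma> :: "3 \<Rightarrow> 3" assume "bij \<sigma>"
    then have "\<sigma> 1 \<noteq> \<sigma> 2" "\<sigma> 1 \<noteq> \<sigma> 3" "\<sigma> 2 \<noteq> \<sigma> 3"
      by (simp_all add: bij_def inj_eq)
    then show "X (\<sigma> 1) ^ a * X (\<sigma> 2) ^ b * X (\<sigma> 3) ^ c \<in> ?B"
      using exhaust_3[of "\<sigma> 1"] exhaust_3[of "\<sigma> 2"] exhaust_3[of "\<sigma> 3"]
      by (auto simp: arrangements_def mult_ac)
  qed
next
  have mem: "X i ^ a * X j ^ b * X k ^ c \<in> ?A" if "i \<noteq> j" "i \<noteq> k" "j \<noteq> k" for i j k
  proof -
    define \<sigma> where "\<sigma> n = (if n = 1 then i else if n = 2 then j else k)" for n :: 3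
    have "inj \<sigma>"
    proof (rule injI)
      fix m n assume "\<sigma> m = \<sigma> n"
      then show "m = n"
        using that exhaust_3[of m] exhaust_3[of n] by (auto simp: \<sigma>_def split: if_splits)
    qed
    then have "bij \<sigma>"
      by (simp add: bij_def finite_UNIV_inj_surj)
    then show ?thesis
      by (intro CollectI exI[of _ \<sigma>]) (simp add: \<sigma>_def)
  qed
  show "?B \<subseteq> ?A"
    using mem[of 1 2 3] mem[of 1 3 2] mem[of 2 1 3] mem[of 2 3 1] mem[of 3 1 2] mem[of 3 2 1]
    by (auto simp: arrangements_def mult_ac)
qed

lemma msym_eq_sum_arrangements:
  "msym a b c = (\<Sum>(a, b, c) \<in> arrangements a b c. X 1 ^ a * X 2 ^ b * X 3 ^ c)"
  unfolding msym_def permuted_monomials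
  by (subst sum.reindex) (auto intro: inj_on_subset[OF inj_monomial] intro!: sum.cong)

lemma msym_distinct:
  assumes "a \<noteq> b" "a \<noteq> c" "b \<noteq> c"
  shows "msym a b c = X 3 ^ c * (X 1 ^ a * X 2 ^ b + X 1 ^ b * X 2 ^ a) +
    X 2 ^ c * (X 1 ^ a * X 3 ^ b + X 1 ^ b * X 3 ^ a) +
    X 1 ^ c * (X 2 ^ a * X 3 ^ b + X 2 ^ b * X 3 ^ a)"
  using assms by (simp add: msym_eq_sum_arrangements arrangements_def algebra_simps)

definition partitions3 :: "nat \<Rightarrow> (nat \<times> nat \<times> nat) set" where
  "partitions3 N = {(a, b, c). a \<ge> b \<and> b \<ge> c \<and> a + b + c = N}"

lemma finite_partitions3: "finite (partitions3 N)"
  by (rule finite_subset[OF _ finite_simplex[of N]]) (auto simp: partitions3_def simplex_def)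

lemma simplex_eq_Union_arrangements:
  "simplex N = (\<Union>(a, b, c) \<in> partitions3 N. arrangements a b c)"
proof
  show "simplex N \<subseteq> (\<Union>(a, b, c) \<in> partitions3 N. arrangements a b c)"
  proof clarify
    fix a b c assume "(a, b, c) \<in> simplex N"
    then have N: "a + b + c = N" by (simp add: simplex_def)
    have mem: "(a, b, c) \<in> arrangements u v w \<Longrightarrow> u \<ge> v \<Longrightarrow> v \<ge> w \<Longrightarrow> u + v + w = N \<Longrightarrow>
        (a, b, c) \<in> (\<Union>(a, b, c) \<in> partitions3 N. arrangements a b c)" for u v w
      by (rule UN_I[of "(u, v, w)"]) (simp_all add: partitions3_def)
    consider "a \<ge> b \<and> b \<ge> c" | "a \<ge> c \<and> c \<ge> b" | "b \<ge> a \<and> a \<ge> c"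
      | "b \<ge> c \<and> c \<ge> a" | "c \<ge> a \<and> a \<ge> b" | "c \<ge> b \<and> b \<ge> a"
      by linarith
    then show "(a, b, c) \<in> (\<Union>(a, b, c) \<in> partitions3 N. arrangements a b c)"
      using mem[of a b c] mem[of a c b] mem[of b a c] mem[of b c a] mem[of c a b] mem[of c b a] N
      by cases (simp_all only: arrangements_def insert_iff simp_thms add.commute add.left_commute
        add.assoc)
  qed
qed (auto simp: partitions3_def arrangements_def simplex_def)

text \<open>
  The arrangements of the sorted triples partition the simplex, and a symmetric coefficient function
  is constant on each part.
\<close>

lemma sum_msym_eq_ternary_form:
  fixes f :: "nat \<Rightarrow> nat \<Rightarrow> nat \<Rightarrow> f2poly3"
  assumes "\<And>a b c. a + b + c = N \<Longrightarrow> f a b c = f b a c"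
    and "\<And>a b c. a + b + c = N \<Longrightarrow> f a b c = f a c b"
  shows "(\<Sum>(a, b, c) \<in> partitions3 N. f a b c * msym a b c) = ternary_form N f (X 1) (X 2) (X 3)"
proof -
  define g where "g = (\<lambda>(a, b, c). f a b c * X 1 ^ a * X 2 ^ b * X 3 ^ c)"
  have part: "f a b c * msym a b c = sum g (arrangements a b c)"
    if "(a, b, c) \<in> partitions3 N" for a b c
  proof -
    have N: "a + b + c = N" using that by (simp add: partitions3_def)
    have f1: "f a b c = f b a c" "f a b c = f a c b"
      using N assms by simp_all
    have f2: "f b a c = f b c a" "f a c b = f c a b"
      using N by (simp_all add: assms(1)[of a c b] assms(2)[of b a c])
    have f3: "f b c a = f c b a" "f c a b = f c b a"
      using N by (simp_all add: assms(1)[of b c a] assms(2)[of c a b])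
    have "f a' b' c' = f a b c" if t: "(a', b', c') \<in> arrangements a b c" for a' b' c'
    proof -
      consider "(a', b', c') = (a, b, c)" | "(a', b', c') = (a, c, b)" | "(a', b', c') = (b, a, c)"
        | "(a', b', c') = (b, c, a)" | "(a', b', c') = (c, a, b)" | "(a', b', c') = (c, b, a)"
        using t unfolding arrangements_def by blast
      then show ?thesis
        by cases (simp_all only: prod.inject f1 f2 f3)
    qed
    then show ?thesis
      unfolding msym_eq_sum_arrangements sum_distrib_left g_def
      by (intro sum.cong) (auto simp: mult.assoc)
  qed
  have "ternary_form N f (X 1) (X 2) (X 3) = sum g (simplex N)"
    by (simp add: ternary_form_def g_def)
  also have "\<dots> = (\<Sum>t \<in> partitions3 N. sum g (case t of (a, b, c) \<Rightarrow> arrangements a b c))"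
    unfolding simplex_eq_Union_arrangements
  proof (rule sum.UNION_disjoint)
    show "finite (partitions3 N)"
      by (rule finite_partitions3)
    show "\<forall>t\<in>partitions3 N. finite (case t of (a, b, c) \<Rightarrow> arrangements a b c)"
      by (auto simp: arrangements_def)
    show "\<forall>s\<in>partitions3 N. \<forall>t\<in>partitions3 N. s \<noteq> t \<longrightarrow>
        (case s of (a, b, c) \<Rightarrow> arrangements a b c) \<inter> (case t of (a, b, c) \<Rightarrow> arrangements a b c) = {}"
      by (auto simp: partitions3_def arrangements_def)
  qed
  also have "\<dots> = (\<Sum>(a, b, c) \<in> partitions3 N. f a b c * msym a b c)"
    by (intro sum.cong) (auto simp: part)
  finally show ?thesis by simp
qed

section \<open>The three quotients\<close>

lemma CHAR_f2poly3: "CHAR(f2poly3) = 2"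
proof (rule CHAR_eq_posI)
  have bit: "b + b = 0" for b :: bit
    by (cases b) simp_all
  have "(1::f2poly3) + 1 = 0"
    by (rule poly_mapping_eqI) (simp only: lookup_add lookup_zero bit)
  then show "of_nat 2 = (0 :: f2poly3)" by simp
  show "of_nat x \<noteq> (0 :: f2poly3)" if "0 < x" "x < 2" for x
    using that by (cases "x = 1") auto
qed simp

lemma X_nonzero: "X i \<noteq> 0"
  by (metis X_def lookup_single_eq lookup_zero zero_neq_one)

lemma denominator_eq_moore: "msym (2 ^ 0) (2 ^ 1) (2 ^ 2) = moore (X 1) (X 2) (X 3)"
  unfolding moore_def
  by (simp add: msym_distinct numeral_eq_Suc algebra_simps cancel_CHAR_2[OF CHAR_f2poly3])

lemma interior_choose_symmetric:
  assumes "a + b + c = 2 ^ l - 1"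
  shows "(interior_choose a b c :: f2poly3) = interior_choose b a c"
    and "(interior_choose a b c :: f2poly3) = interior_choose a c b"
  using interior_choose_swap12[OF CHAR_f2poly3 assms] interior_choose_swap23 by blast+

lemma p_0_eq_interior_form:
  assumes "3 \<le> l"
  shows "p l 0 = ternary_form (2 ^ l - 1) interior_choose (X 1) (X 2) (X 3)"
proof (rule p_eqI)
  have "2 ^ 3 \<le> (2::nat) ^ l"
    using assms by (intro power_increasing) auto
  then have "p_numer l 0 = X 3 ^ 2 ^ l * (X 1 ^ 2 * X 2 ^ 4 + X 1 ^ 4 * X 2 ^ 2) +
    X 2 ^ 2 ^ l * (X 1 ^ 2 * X 3 ^ 4 + X 1 ^ 4 * X 3 ^ 2) +
    X 1 ^ 2 ^ l * (X 2 ^ 2 * X 3 ^ 4 + X 2 ^ 4 * X 3 ^ 2)"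
    unfolding p_numer_simps by (intro msym_distinct) auto
  then show "ternary_form (2 ^ l - 1) interior_choose (X 1) (X 2) (X 3) * msym (2 ^ 0) (2 ^ 1) (2 ^ 2) =
      p_numer l 0"
    using interior_form_times_moore[OF CHAR_f2poly3, of l "X 1" "X 2" "X 3"] assms
    unfolding denominator_eq_moore
    by (simp add: mult.commute[of "ternary_form _ _ _ _ _"] power2_eq_square power4_eq_xxxx
        algebra_simps cancel_CHAR_2[OF CHAR_f2poly3])
qed

lemma p_1_eq_middle_form:
  assumes "3 \<le> l"
  shows "p l 1 = ternary_form (2 ^ l - 2) middle_coeff (X 1) (X 2) (X 3)"
    (is "_ = ?q")
proof (rule p_eqI)
  have "2 ^ 3 \<le> (2::nat) ^ l"
    using assms by (intro power_increasing) auto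
  then have "p_numer l 1 = X 3 ^ 2 ^ l * (X 1 ^ 1 * X 2 ^ 4 + X 1 ^ 4 * X 2 ^ 1) +
    X 2 ^ 2 ^ l * (X 1 ^ 1 * X 3 ^ 4 + X 1 ^ 4 * X 3 ^ 1) +
    X 1 ^ 2 ^ l * (X 2 ^ 1 * X 3 ^ 4 + X 2 ^ 4 * X 3 ^ 1)"
    unfolding p_numer_simps by (intro msym_distinct) auto
  then show "?q * msym (2 ^ 0) (2 ^ 1) (2 ^ 2) = p_numer l 1"
    unfolding denominator_eq_moore mult.commute[of ?q]
      middle_form_times_moore[OF CHAR_f2poly3 assms X_nonzero X_nonzero X_nonzero]
    by (simp add: power3_eq_cube power4_eq_xxxx algebra_simps)
qed

lemma p_2_eq_shifted_form:
  assumes "3 \<le> l"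
  shows "p l 2 = ternary_form (2 ^ l - 4)
    (\<lambda>a b c. 1 + interior_choose (Suc a) (Suc b) (Suc c)) (X 1) (X 2) (X 3)"
    (is "_ = ?q")
proof (rule p_eqI)
  have "2 ^ 3 \<le> (2::nat) ^ l"
    using assms by (intro power_increasing) auto
  then have "p_numer l 2 = X 3 ^ 2 ^ l * (X 1 ^ 1 * X 2 ^ 2 + X 1 ^ 2 * X 2 ^ 1) +
    X 2 ^ 2 ^ l * (X 1 ^ 1 * X 3 ^ 2 + X 1 ^ 2 * X 3 ^ 1) +
    X 1 ^ 2 ^ l * (X 2 ^ 1 * X 3 ^ 2 + X 2 ^ 2 * X 3 ^ 1)"
    unfolding p_numer_simps by (intro msym_distinct) auto
  moreover have "2 \<le> l" using assms by simp
  ultimately show "?q * msym (2 ^ 0) (2 ^ 1) (2 ^ 2) = p_numer l 2"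
    unfolding denominator_eq_moore mult.commute[of ?q]
    by (simp add: shifted_form_times_moore[OF CHAR_f2poly3 _ X_nonzero X_nonzero X_nonzero]
        power2_eq_square algebra_simps)
qed

text \<open>
  By Pascal's rule \<open>(b + c + 1) choose c\<close>, the shift in \<open>b\<close>, is the shift in \<open>a\<close> plus
  \<open>(b + c) choose (c - 1)\<close>, and the two equal summands cancel.
\<close>

lemma middle_coeff_interior:
  assumes "CHAR('a::comm_ring_1) = 2" "0 < a" "0 < b" "0 < c"
  shows "middle_coeff a b c =
    (of_nat (1 + ((b + c) choose (c - 1)) + ((b + c + 1) choose (c + 1))) :: 'a)"
proof -
  obtain d where c: "c = Suc d"
    using assms(4) gr0_implies_Suc by blast
  have "Suc (b + c) choose c = (b + c choose c) + (b + c choose (c - 1))"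
    by (simp add: c)
  then show ?thesis
    using assms(2-4)
    by (simp add: middle_coeff_def interior_choose_def ac_simps cancel_CHAR_2[OF assms(1)])
qed

lemma middle_coeff_symmetric:
  assumes "a + b + c = 2 ^ l - 2" "2 \<le> l"
  shows "(middle_coeff a b c :: f2poly3) = middle_coeff b a c"
    and "(middle_coeff a b c :: f2poly3) = middle_coeff a c b"
proof -
  have "2 ^ 2 \<le> (2::nat) ^ l"
    using assms(2) by (intro power_increasing) auto
  then have N: "Suc a + b + c = 2 ^ l - 1" "a + Suc b + c = 2 ^ l - 1" "a + b + Suc c = 2 ^ l - 1"
    using assms(1) by simp_all
  show "(middle_coeff a b c :: f2poly3) = middle_coeff b a c"
    unfolding middle_coeff_def interior_choose_symmetric(1)[OF N(1)]
      interior_choose_symmetric(1)[OF N(2)] interior_choose_symmetric(1)[OF N(3)]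
    by (simp add: ac_simps)
  show "(middle_coeff a b c :: f2poly3) = middle_coeff a c b"
    unfolding middle_coeff_def interior_choose_symmetric(2)[OF N(1)]
      interior_choose_symmetric(2)[OF N(2)] interior_choose_symmetric(2)[OF N(3)]
    by (simp add: ac_simps)
qed

theorem theorem1p3:
  fixes l :: nat
  assumes "l \<ge> 3"
  shows
    "p l 0 =
      (\<Sum>(a, b, c) \<in> {(a, b, c). a \<ge> b \<and> b \<ge> c \<and> c > 0 \<and> a + b + c = 2 ^ l - 1}.
         of_nat ((b + c) choose c) * msym a b c) \<and>
     p l 1 =
      (\<Sum>(a, b) \<in> {(a, b). a \<ge> b \<and> b > 0 \<and> a + b = 2 ^ l - 2}.
         of_nat (1 + b) * msym a b 0) +
      (\<Sum>(a, b, c) \<in> {(a, b, c). a \<ge> b \<and> b \<ge> c \<and> c > 0 \<and> a + b + c = 2 ^ l - 2}.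
         of_nat (1 + ((b + c) choose (c - 1)) + ((b + c + 1) choose (c + 1))) * msym a b c) \<and>
     p l 2 =
      (\<Sum>(a, b, c) \<in> {(a, b, c). a \<ge> b \<and> b \<ge> c \<and> c \<ge> 0 \<and> a + b + c = 2 ^ l - 4}.
         of_nat (1 + ((b + c + 2) choose (c + 1))) * msym a b c)"
proof (intro conjI)
  have "2 ^ 3 \<le> (2::nat) ^ l"
    using assms by (intro power_increasing) auto
  then have L: "8 \<le> (2::nat) ^ l" by simp
  have "p l 0 = (\<Sum>(a, b, c) \<in> partitions3 (2 ^ l - 1). interior_choose a b c * msym a b c)"
    unfolding p_0_eq_interior_form[OF assms]
    by (rule sum_msym_eq_ternary_form[symmetric]) (rule interior_choose_symmetric; simp)+
  also have "\<dots> = (\<Sum>(a, b, c) \<in> {(a, b, c). a \<ge> b \<and> b \<ge> c \<and> c > 0 \<and> a + b + c = 2 ^ l - 1}.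
      of_nat ((b + c) choose c) * msym a b c)"
    by (rule sum.mono_neutral_cong_right[OF finite_partitions3])
      (auto simp: partitions3_def interior_choose_def split: if_splits)
  finally show "p l 0 = \<dots>" .

  have l2: "2 \<le> l" using assms by simp
  \<comment> \<open>\<open>?E\<close> and \<open>?I\<close> cover all sorted triples but \<open>(2 ^ l - 2, 0, 0)\<close>, where the coefficient is \<open>0\<close>.\<close>
  let ?B = "{(a, b). a \<ge> b \<and> b > 0 \<and> a + b = 2 ^ l - (2::nat)}"
  let ?I = "{(a, b, c). a \<ge> b \<and> b \<ge> c \<and> c > 0 \<and> a + b + c = 2 ^ l - (2::nat)}"
  let ?E = "(\<lambda>(a, b). (a, b, 0::nat)) ` ?B"
  have "p l 1 = (\<Sum>(a, b, c) \<in> partitions3 (2 ^ l - 2). middle_coeff a b c * msym a b c)"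
    unfolding p_1_eq_middle_form[OF assms]
    by (rule sum_msym_eq_ternary_form[symmetric]) (rule middle_coeff_symmetric[OF _ l2]; simp)+
  also have "\<dots> = (\<Sum>(a, b, c) \<in> ?E \<union> ?I. middle_coeff a b c * msym a b c)"
  proof (rule sum.mono_neutral_right[OF finite_partitions3])
    show "?E \<union> ?I \<subseteq> partitions3 (2 ^ l - 2)"
      by (auto simp: partitions3_def)
    show "\<forall>t \<in> partitions3 (2 ^ l - 2) - (?E \<union> ?I).
        (case t of (a, b, c) \<Rightarrow> middle_coeff a b c * msym a b c) = 0"
    proof (rule ballI)
      fix t
      assume "t \<in> partitions3 (2 ^ l - 2) - (?E \<union> ?I)"
      moreover obtain a b c where t: "t = (a, b, c)"
        by (cases t)
      ultimately have "b = 0" "c = 0"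
        by (auto simp: partitions3_def image_iff)
      then show "(case t of (a, b, c) \<Rightarrow> middle_coeff a b c * msym a b c) = 0"
        by (simp add: t middle_coeff_def interior_choose_def)
    qed
  qed
  also have "\<dots> = (\<Sum>(a, b, c) \<in> ?E. middle_coeff a b c * msym a b c) +
      (\<Sum>(a, b, c) \<in> ?I. middle_coeff a b c * msym a b c)"
  proof (rule sum.union_disjoint)
    show "finite ?E"
      by (rule finite_subset[OF _ finite_partitions3[of "2 ^ l - 2"]]) (auto simp: partitions3_def)
    show "finite ?I"
      by (rule finite_subset[OF _ finite_partitions3[of "2 ^ l - 2"]]) (auto simp: partitions3_def)
  qed auto
  also have "(\<Sum>(a, b, c) \<in> ?E. middle_coeff a b c * msym a b c) =
      (\<Sum>(a, b) \<in> ?B. of_nat (1 + b) * msym a b 0)"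
    by (subst sum.reindex) (auto simp: inj_on_def middle_coeff_def interior_choose_def intro!: sum.cong)
  also have "(\<Sum>(a, b, c) \<in> ?I. middle_coeff a b c * msym a b c) = (\<Sum>(a, b, c) \<in> ?I.
      of_nat (1 + ((b + c) choose (c - 1)) + ((b + c + 1) choose (c + 1))) * msym a b c)"
    by (rule sum.cong[OF refl])
      (auto simp only: mem_Collect_eq prod.case middle_coeff_interior[OF CHAR_f2poly3])
  finally show "p l 1 = (\<Sum>(a, b) \<in> ?B. of_nat (1 + b) * msym a b 0) +
      (\<Sum>(a, b, c) \<in> ?I.
         of_nat (1 + ((b + c) choose (c - 1)) + ((b + c + 1) choose (c + 1))) * msym a b c)" .

  have shifted_sym:
    "(interior_choose (Suc a) (Suc b) (Suc c) :: f2poly3) = interior_choose (Suc b) (Suc a) (Suc c)"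
    "(interior_choose (Suc a) (Suc b) (Suc c) :: f2poly3) = interior_choose (Suc a) (Suc c) (Suc b)"
    if "a + b + c = 2 ^ l - 4" for a b c
    by (rule interior_choose_symmetric[of _ _ _ l], use that L in simp)+
  have "p l 2 = (\<Sum>(a, b, c) \<in> partitions3 (2 ^ l - 4).
      (1 + interior_choose (Suc a) (Suc b) (Suc c)) * msym a b c)"
    unfolding p_2_eq_shifted_form[OF assms]
    by (rule sum_msym_eq_ternary_form[symmetric])
      (rule arg_cong[where f = "(+) 1"], erule shifted_sym)+
  also have "\<dots> = (\<Sum>(a, b, c) \<in> {(a, b, c). a \<ge> b \<and> b \<ge> c \<and> c \<ge> 0 \<and> a + b + c = 2 ^ l - 4}.
      of_nat (1 + ((b + c + 2) choose (c + 1))) * msym a b c)"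
    by (rule sum.cong) (auto simp: partitions3_def interior_choose_def)
  finally show "p l 2 = \<dots>" .
qed

end
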